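(* Let $X$ and $Z$ be non-trivial real locally convex topological linear spaces with topological duals $X^*$, $Z^*$, let $C \subseteq Z$ be a convex cone with $0 \in C$, and let $f \colon X \to \mathcal G(Z, C)$ be a function. Then the following are equivalent: (a) There is $(x^*, z^* ) \in X^* \times (C^+\setminus\{0\})$ such that $f(x) = S_{(x^*, z^* )}(x)$ for all $x \in X$. (b) $\operatorname{graph} f$ is a closed homogeneous half-space of $X \times Z$ and $f(0) \neq Z$. (c) $f$ is positively homogeneous, additive, lattice-lower semicontinuous at $0 \in X$, and $f(0) \subseteq Z$ is a non-trivial, closed homogeneous half-space.
   Context: A cone is a set closed under multiplication by scalars $t>0$. $C^+ = \{z^* \in Z^* \mid \forall z \in C\colon z^*(z)\ge 0\}$. $\mathcal G(Z,C) = \{A \subseteq Z \mid A = \operatorname{cl}\operatorname{co}(A + C)\}$ (this includes $\emptyset$ and $Z$), with Minkowski addition, $A + \emptyset = \emptyset$, and $A \oplus B = \operatorname{cl}(A+B)$. $S_{(x^*,z^* )}(x) = \{z \in Z \mid x^*(x) \leq z^*(z)\}$. $\operatorname{graph} f = \{(x,z) \in X\times Z \mid z \in f(x)\}$. A closed homogeneous half-space of a topological linear space $E$ is a set $\{e \in E \mid e^*(e) \ge 0\}$ for some $e^* \in E^*\setminus\{0\}$. $f$ is positively homogeneous if $\operatorname{graph} f$ is a cone in $X \times Z$ (equivalently $f(tx) = t f(x)$ for all $t>0$, $x \in X$); $f$ is additive if $f(x_1+x_2) = f(x_1)\oplus f(x_2)$ for all $x_1,x_2\in X$. $f$ is lattice-lower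 semicontinuous at $\bar x \in X$ if $f(\bar x) \supseteq \liminf_{x\to\bar x} f(x) := \bigcap_{U \in \mathcal N_X} \operatorname{cl}\operatorname{co}\bigcup_{x \in \bar x + U} f(x)$, where $\mathcal N_X$ is a neighborhood base of $0 \in X$. *)

theory Defs
  imports "HOL-Analysis.Analysis" "HOL-Library.Set_Algebras"
begin

text \<open>
  Real locally convex topological linear spaces. No separation axiom is imposed.
  The convergence condition says that scalar multiplication is jointly continuous.
  The constant \<open>convex\<close> is not usable inside the class specification, hence its unfolding.
\<close>

class real_tvs = real_vector + topological_ab_group_add +
  assumes tendsto_scaleR_Pair:
    "LIM x (nhds a \<times>\<^sub>F nhds b). fst x *\<^sub>R snd x :> nhds (a *\<^sub>R b)"

class real_lcs = real_tvs +
  assumes convex_nhds_base_expanded: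
    "open U \<Longrightarrow> 0 \<in> U \<Longrightarrow>
      \<exists>V. open V \<and>
        (\<forall>x\<in>V. \<forall>y\<in>V. \<forall>u\<ge>0. \<forall>v\<ge>0. u + v = 1 \<longrightarrow> u *\<^sub>R x + v *\<^sub>R y \<in> V) \<and>
        0 \<in> V \<and> V \<subseteq> U"

lemma convex_nhds_base:
  fixes U :: "'a::real_lcs set"
  assumes "open U" and "0 \<in> U"
  shows "\<exists>V. open V \<and> convex V \<and> 0 \<in> V \<and> V \<subseteq> U"
  using convex_nhds_base_expanded[OF assms] unfolding convex_def .

lemma tendsto_scaleR_tvs:
  fixes b :: "'a::real_tvs"
  assumes "(f \<longlongrightarrow> a) F" "(g \<longlongrightarrow> b) F"
  shows "((\<lambda>x. f x *\<^sub>R g x) \<longlongrightarrow> a *\<^sub>R b) F"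
  using filterlim_compose[OF tendsto_scaleR_Pair, of "\<lambda>x. (f x, g x)" a b F] assms
  by (simp add: nhds_prod[symmetric] tendsto_Pair)

lemma tendsto_fst_snd_nhds:
  "(fst \<longlongrightarrow> p) (nhds p \<times>\<^sub>F nhds q)" "(snd \<longlongrightarrow> q) (nhds p \<times>\<^sub>F nhds q)"
  by (simp_all add: filterlim_fst filterlim_snd)

instance prod :: (topological_monoid_add, topological_monoid_add) topological_monoid_add
proof
  fix a b :: "'a \<times> 'b"
  show "LIM x (nhds a \<times>\<^sub>F nhds b). fst x + snd x :> nhds (a + b)"
    unfolding plus_prod_def by (intro tendsto_intros tendsto_fst_snd_nhds)
qed

instance prod :: (topological_comm_monoid_add, topological_comm_monoid_add)
  topological_comm_monoid_add ..

instance prod :: (topological_group_add, topological_group_add) topological_group_add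
proof
  fix a :: "'a \<times> 'b"
  show "(uminus \<longlongrightarrow> - a) (nhds a)"
    unfolding uminus_prod_def by (intro tendsto_intros filterlim_ident)
qed

instance prod :: (topological_ab_group_add, topological_ab_group_add) topological_ab_group_add ..

instance prod :: (real_tvs, real_tvs) real_tvs
proof
  fix b :: "'a \<times> 'b" and r :: real
  show "LIM x (nhds r \<times>\<^sub>F nhds b). fst x *\<^sub>R snd x :> nhds (r *\<^sub>R b)"
    unfolding scaleR_prod_def
    by (intro tendsto_Pair tendsto_scaleR_tvs tendsto_fst tendsto_snd tendsto_fst_snd_nhds)
qed

instance prod :: (real_lcs, real_lcs) real_lcs
proof
  fix U :: "('a \<times> 'b) set"
  assume "open U" "0 \<in> U"
  then obtain A B where AB: "open A" "open B" "0 \<in> A \<times> B" "A \<times> B \<subseteq> U"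
    by (rule open_prod_elim)
  then have "0 \<in> A" "0 \<in> B"
    by (auto simp: zero_prod_def)
  obtain V where V: "open V" "convex V" "0 \<in> V" "V \<subseteq> A"
    using convex_nhds_base[OF \<open>open A\<close> \<open>0 \<in> A\<close>] by blast
  obtain W where W: "open W" "convex W" "0 \<in> W" "W \<subseteq> B"
    using convex_nhds_base[OF \<open>open B\<close> \<open>0 \<in> B\<close>] by blast
  have "V \<times> W \<subseteq> U"
    using Sigma_mono[of V A "\<lambda>_. W" "\<lambda>_. B"] V(4) W(4) AB(4) by (meson order_trans)
  then show "\<exists>V. open V \<and>
      (\<forall>x\<in>V. \<forall>y\<in>V. \<forall>u\<ge>0. \<forall>v\<ge>0. u + v = 1 \<longrightarrow> u *\<^sub>R x + v *\<^sub>R y \<in> V) \<and>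
      0 \<in> V \<and> V \<subseteq> U"
    unfolding convex_def[symmetric] using V W
    by (intro exI[of _ "V \<times> W"] conjI open_Times convex_Times) (auto simp: zero_prod_def)
qed

text \<open>The topological dual, as a set of functions; its zero element is \<open>\<lambda>_. 0\<close>.\<close>

definition dual :: "('a::real_lcs \<Rightarrow> real) set" where
  "dual = {\<phi>. linear \<phi> \<and> continuous_on UNIV \<phi>}"

text \<open>
  Unlike in the library constants \<open>cone\<close>, \<open>conic\<close> and \<open>convex_cone\<close>, only scalars \<open>t > 0\<close> are
  used, so a cone may be empty and need not contain \<open>0\<close>.
\<close>

definition is_cone :: "'a::real_vector set \<Rightarrow> bool" where
  "is_cone K \<longleftrightarrow> (\<forall>t>0. \<forall>x\<in>K. t *\<^sub>R x \<in> K)"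

definition dual_cone :: "'a::real_lcs set \<Rightarrow> ('a \<Rightarrow> real) set" where
  "dual_cone C = {\<phi> \<in> dual. \<forall>z\<in>C. 0 \<le> \<phi> z}"

text \<open>Addition of sets is Minkowski addition; in particular \<open>A + {} = {}\<close>.\<close>

definition closed_convex_upper_sets :: "'a::real_lcs set \<Rightarrow> 'a set set" where
  "closed_convex_upper_sets C = {A. A = closure (convex hull (A + C))}"

definition closed_plus :: "'a::real_lcs set \<Rightarrow> 'a set \<Rightarrow> 'a set" where
  "closed_plus A B = closure (A + B)"

definition halfspace_map ::
    "('a::real_lcs \<Rightarrow> real) \<Rightarrow> ('b::real_lcs \<Rightarrow> real) \<Rightarrow> 'a \<Rightarrow> 'b set" where
  "halfspace_map \<xi> \<zeta> x = {z. \<xi> x \<le> \<zeta> z}"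

definition set_graph :: "('a \<Rightarrow> 'b set) \<Rightarrow> ('a \<times> 'b) set" where
  "set_graph f = {(x, z). z \<in> f x}"

definition closed_homogeneous_halfspace :: "'a::real_lcs set \<Rightarrow> bool" where
  "closed_homogeneous_halfspace H \<longleftrightarrow> (\<exists>\<phi>\<in>dual - {\<lambda>_. 0}. H = {e. 0 \<le> \<phi> e})"

definition positively_homogeneous :: "('a::real_lcs \<Rightarrow> 'b::real_lcs set) \<Rightarrow> bool" where
  "positively_homogeneous f \<longleftrightarrow> is_cone (set_graph f)"

definition set_additive :: "('a::real_lcs \<Rightarrow> 'b::real_lcs set) \<Rightarrow> bool" where
  "set_additive f \<longleftrightarrow> (\<forall>x1 x2. f (x1 + x2) = closed_plus (f x1) (f x2))"

text \<open>
  The neighborhood base of \<open>0\<close> used here consists of all open sets containing \<open>0\<close>; the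
  intersection does not depend on the choice of the base.
\<close>

definition lattice_liminf :: "('a::real_lcs \<Rightarrow> 'b::real_lcs set) \<Rightarrow> 'a \<Rightarrow> 'b set" where
  "lattice_liminf f a =
     (\<Inter>U\<in>{U. open U \<and> 0 \<in> U}. closure (convex hull (\<Union>x\<in>(+) a ` U. f x)))"

definition lattice_lsc_at :: "('a::real_lcs \<Rightarrow> 'b::real_lcs set) \<Rightarrow> 'a \<Rightarrow> bool" where
  "lattice_lsc_at f a \<longleftrightarrow> lattice_liminf f a \<subseteq> f a"

end

theory Submission
  imports Defs
begin

text \<open>
  For (c) \<open>\<Longrightarrow>\<close> (a), write \<open>f 0 = {z. 0 \<le> \<zeta> z}\<close>. From \<open>cl (f x + f 0) = f x\<close> and
  \<open>cl (f x + f (- x)) = f 0\<close>, every value \<open>f x\<close> is closed, nonempty, stable under adding elements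
  of this half-space, and \<open>\<zeta>\<close> is bounded below on it. Hence \<open>f x = {z. \<xi> x \<le> \<zeta> z}\<close> for a unique
  real number \<open>\<xi> x\<close>. Additivity and homogeneity of \<open>f\<close> make \<open>\<xi>\<close> linear, and semicontinuity of
  \<open>f\<close> at \<open>0\<close> bounds \<open>\<xi>\<close> from below near \<open>0\<close>, which makes it continuous.
\<close>

section \<open>Half-spaces of a linear functional\<close>

lemma closed_dual_halfspace:
  assumes "\<zeta> \<in> dual"
  shows "closed {z. r \<le> \<zeta> z}"
  using assms by (intro closed_Collect_le continuous_on_const) (simp add: dual_def)

lemma convex_linear_halfspace:
  fixes \<zeta> :: "'a::real_vector \<Rightarrow> real"
  assumes "linear \<zeta>"
  shows "convex {z. r \<le> \<zeta> z}"
  using convex_linear_vimage[OF assms, of "{r..}"] by (simp add: vimage_def)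

lemma linear_real_surj:
  fixes \<zeta> :: "'a::real_vector \<Rightarrow> real"
  assumes "linear \<zeta>" "\<zeta> \<noteq> (\<lambda>_. 0)"
  obtains z where "\<zeta> z = r"
proof -
  obtain w where "\<zeta> w \<noteq> 0"
    using assms(2) by auto
  then have "\<zeta> ((r / \<zeta> w) *\<^sub>R w) = r"
    by (simp add: linear_scale[OF assms(1)])
  then show thesis
    by (rule that)
qed

text \<open>Points where \<zeta> attains r and s recover the bound from the set. This turns
  equations between half-spaces into equations between reals.\<close>

lemma linear_halfspace_inject:
  fixes \<zeta> :: "'a::real_vector \<Rightarrow> real"
  assumes "linear \<zeta>" "\<zeta> \<noteq> (\<lambda>_. 0)"
  shows "{z. r \<le> \<zeta> z} = {z. s \<le> \<zeta> z} \<longleftrightarrow> r = s"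
proof
  assume eq: "{z. r \<le> \<zeta> z} = {z. s \<le> \<zeta> z}"
  obtain y z where "\<zeta> y = r" "\<zeta> z = s"
    using linear_real_surj[OF assms] by metis
  moreover from this have "y \<in> {z. s \<le> \<zeta> z}" "z \<in> {z. r \<le> \<zeta> z}"
    using eq by auto
  ultimately show "r = s"
    by simp
qed simp

text \<open>Splitting z as \<open>w + (z - w)\<close> with \<open>\<zeta> w = r\<close> gives the
  nontrivial inclusion. Hence the plain sum is already a half-space, and for continuous \<zeta>
  taking the closure adds nothing.\<close>

lemma linear_halfspace_plus:
  fixes \<zeta> :: "'a::real_vector \<Rightarrow> real"
  assumes "linear \<zeta>" "\<zeta> \<noteq> (\<lambda>_. 0)"
  shows "{z. r \<le> \<zeta> z} + {z. s \<le> \<zeta> z} = {z. r + s \<le> \<zeta> z}"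
proof (intro equalityI subsetI)
  fix z
  assume "z \<in> {z. r \<le> \<zeta> z} + {z. s \<le> \<zeta> z}"
  then show "z \<in> {z. r + s \<le> \<zeta> z}"
    by (auto elim!: set_plus_elim simp: linear_add[OF assms(1)])
next
  fix z
  assume z: "z \<in> {z. r + s \<le> \<zeta> z}"
  obtain w where w: "\<zeta> w = r"
    using linear_real_surj[OF assms] .
  have "w + (z - w) \<in> {z. r \<le> \<zeta> z} + {z. s \<le> \<zeta> z}"
    using z w by (intro set_plus_intro) (auto simp: linear_diff[OF assms(1)])
  then show "z \<in> {z. r \<le> \<zeta> z} + {z. s \<le> \<zeta> z}"
    by simp
qed

lemma closed_plus_halfspace:
  assumes "\<zeta> \<in> dual" "\<zeta> \<noteq> (\<lambda>_. 0)"
  shows "closed_plus {z. r \<le> \<zeta> z} {z. s \<le> \<zeta> z} = {z. r + s \<le> \<zeta> z}"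
  using assms closed_dual_halfspace[OF assms(1)]
  by (simp add: closed_plus_def dual_def linear_halfspace_plus)

lemma set_plus_subset_closed_plus: "A + B \<subseteq> closed_plus A B"
  unfolding closed_plus_def by (rule closure_subset)

text \<open>A one-sided bound suffices because g is odd: used for both signs of a scaled difference,
  it becomes a two-sided estimate.\<close>

lemma linear_bounded_below_nhds_imp_continuous:
  fixes g :: "'a::real_lcs \<Rightarrow> real"
  assumes g: "linear g" and U: "open U" "0 \<in> U" "\<And>x. x \<in> U \<Longrightarrow> -1 < g x"
  shows "continuous_on UNIV g"
  unfolding continuous_on_def
proof (intro ballI tendstoI)
  fix a :: 'a and e :: real
  assume e: "0 < e"
  \<comment> \<open>For c = 1 and c = -1 this says \<open>g y - g a > -e\<close> and
    \<open>g y - g a < e\<close>; dividing by e converts the fixed bound -1 into the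
    tolerance.\<close>
  have *: "\<forall>\<^sub>F y in at a. -1 < g ((c / e) *\<^sub>R (y - a))" for c
  proof -
    have "((\<lambda>y. (c / e) *\<^sub>R (y - a)) \<longlongrightarrow> (c / e) *\<^sub>R (a - a)) (at a)"
      by (intro tendsto_scaleR_tvs tendsto_intros)
    then have "\<forall>\<^sub>F y in at a. (c / e) *\<^sub>R (y - a) \<in> U"
      using U by (intro topological_tendstoD) auto
    then show ?thesis
      by eventually_elim (rule U)
  qed
  show "\<forall>\<^sub>F y in at a. dist (g y) (g a) < e"
    using *[of 1] *[of "-1"]
  proof eventually_elim
    case (elim y)
    then show ?case
      using e by (simp add: linear_scale[OF g] linear_diff[OF g] dist_real_def field_simps)
  qed
qed

text \<open>The bound is the infimum of \<zeta> on A. A point strictly above it differs from some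
  element of A by a vector of the half-space that A absorbs; closedness supplies the boundary
  points.\<close>

lemma closed_upper_set_eq_halfspace:
  fixes A :: "'a::real_lcs set"
  assumes \<zeta>: "\<zeta> \<in> dual" "\<zeta> \<noteq> (\<lambda>_. 0)"
    and A: "closed A" "A \<noteq> {}" "bdd_below (\<zeta> ` A)"
    and upper: "A + {z. 0 \<le> \<zeta> z} \<subseteq> A"
  shows "\<exists>r. A = {z. r \<le> \<zeta> z}"
proof (intro exI equalityI subsetI)
  let ?r = "Inf (\<zeta> ` A)"
  have lin: "linear \<zeta>"
    using \<zeta> by (simp add: dual_def)
  show "z \<in> {z. ?r \<le> \<zeta> z}" if "z \<in> A" for z
    using that A by (auto intro: cInf_lower)
  have strict: "z \<in> A" if less: "?r < \<zeta> z" for z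
  proof -
    obtain w where w: "w \<in> A" "\<zeta> w < \<zeta> z"
      using cInf_lessD[OF _ less] A by auto
    then have "w + (z - w) \<in> A + {z. 0 \<le> \<zeta> z}"
      by (intro set_plus_intro) (auto simp: linear_diff[OF lin])
    then show ?thesis
      using upper by auto
  qed
  \<comment> \<open>In this direction \<zeta> grows, so z + t w lies strictly above the infimum for
    every t > 0, and z is a limit of points of A.\<close>
  obtain w where w: "\<zeta> w = 1"
    using linear_real_surj[OF lin \<zeta>(2)] .
  fix z
  assume z: "z \<in> {z. ?r \<le> \<zeta> z}"
  have "((\<lambda>t. z + t *\<^sub>R w) \<longlongrightarrow> z + 0 *\<^sub>R w) (at_right 0)"
    by (intro tendsto_add tendsto_const tendsto_scaleR_tvs tendsto_ident_at)
  moreover have "\<forall>\<^sub>F t in at_right 0. z + t *\<^sub>R w \<in> A"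
    using eventually_at_right_less[of "0::real"]
  proof eventually_elim
    case (elim t)
    then show ?case
      using z w by (intro strict) (simp add: linear_add[OF lin] linear_scale[OF lin])
  qed
  ultimately show "z \<in> A"
    using Lim_in_closed_set[OF A(1)] by fastforce
qed

section \<open>Elements of \<open>closed_convex_upper_sets C\<close>\<close>

lemma closed_convex_upper_sets_imp_closed:
  "A \<in> closed_convex_upper_sets C \<Longrightarrow> closed A"
  unfolding closed_convex_upper_sets_def by (metis (mono_tags) closed_closure mem_Collect_eq)

text \<open>Each c in C equals 0 + c and so lies in A + C. When A is the half-space
  \<open>f 0\<close>, this places its functional in the dual cone.\<close>

lemma closed_convex_upper_sets_imp_subset:
  assumes "A \<in> closed_convex_upper_sets C" "0 \<in> A"
  shows "C \<subseteq> A"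
proof
  fix c
  assume "c \<in> C"
  then have "0 + c \<in> A + C"
    using assms(2) by (rule set_plus_intro[rotated])
  then have "0 + c \<in> closure (convex hull (A + C))"
    by (meson closure_subset hull_subset subsetD)
  then show "c \<in> A"
    using assms(1) by (auto simp: closed_convex_upper_sets_def)
qed

section \<open>Maps whose graph is a half-space: (a) and (b)\<close>

lemma halfspace_map_imp_graph_halfspace:
  assumes \<xi>: "\<xi> \<in> dual" and \<zeta>: "\<zeta> \<in> dual" "\<zeta> \<noteq> (\<lambda>_. 0)"
    and f: "\<And>x. f x = halfspace_map \<xi> \<zeta> x"
  shows "closed_homogeneous_halfspace (set_graph f)"
proof -
  let ?\<phi> = "\<lambda>p. \<zeta> (snd p) - \<xi> (fst p)"
  have lin: "linear \<xi>" "linear \<zeta>"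
    using \<xi> \<zeta> by (simp_all add: dual_def)
  have "linear ?\<phi>"
    by (rule linearI)
      (simp_all add: linear_add[OF lin(1)] linear_add[OF lin(2)]
        linear_scale[OF lin(1)] linear_scale[OF lin(2)] algebra_simps)
  moreover have "continuous_on UNIV ?\<phi>"
    using \<xi> \<zeta> unfolding dual_def
    by (auto intro!: continuous_on_diff continuous_on_compose2[of UNIV \<xi>]
        continuous_on_compose2[of UNIV \<zeta>] continuous_on_fst continuous_on_snd continuous_on_id)
  moreover obtain w where "\<zeta> w \<noteq> 0"
    using \<zeta> by auto
  then have "?\<phi> (0, w) \<noteq> 0"
    by (simp add: linear_0[OF lin(1)])
  then have "?\<phi> \<noteq> (\<lambda>_. 0)"
    by metis
  moreover have "set_graph f = {p. 0 \<le> ?\<phi> p}"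
    by (auto simp: set_graph_def f halfspace_map_def)
  ultimately show ?thesis
    unfolding closed_homogeneous_halfspace_def dual_def by (intro bexI[of _ ?\<phi>]) simp_all
qed

lemma graph_halfspace_imp_halfspace_map:
  fixes f :: "'x::real_lcs \<Rightarrow> 'z::real_lcs set"
  assumes "closed_homogeneous_halfspace (set_graph f)"
  obtains \<xi> \<zeta> where "\<xi> \<in> dual" "\<zeta> \<in> dual" "\<And>x. f x = halfspace_map \<xi> \<zeta> x"
proof -
  obtain \<phi> :: "'x \<times> 'z \<Rightarrow> real"
    where \<phi>: "linear \<phi>" "continuous_on UNIV \<phi>" and graph: "set_graph f = {p. 0 \<le> \<phi> p}"
    using assms unfolding closed_homogeneous_halfspace_def dual_def by blast
  \<comment> \<open>The minus sign moves the first component to the other side, so that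
    \<open>0 \<le> \<phi> (x, z)\<close> reads \<open>\<xi> x \<le> \<zeta> z\<close>.\<close>
  define \<xi> where "\<xi> = (\<lambda>x. \<phi> (- x, 0))"
  define \<zeta> where "\<zeta> = (\<lambda>z. \<phi> (0, z))"
  have "linear \<xi>" "linear \<zeta>"
    unfolding \<xi>_def \<zeta>_def
    by (rule linear_compose[OF _ \<phi>(1), unfolded comp_def], rule linearI, simp, simp)+
  moreover have "continuous_on UNIV \<xi>" "continuous_on UNIV \<zeta>"
    unfolding \<xi>_def \<zeta>_def
    by (auto intro!: continuous_on_compose2[OF \<phi>(2)] continuous_on_Pair continuous_on_const
        continuous_on_minus continuous_on_id)
  moreover have "f x = halfspace_map \<xi> \<zeta> x" for x
  proof -
    have "\<phi> (x, z) = \<zeta> z - \<xi> x" for z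
      by (simp add: \<xi>_def \<zeta>_def linear_diff[OF \<phi>(1), symmetric])
    moreover have "f x = {z. (x, z) \<in> set_graph f}"
      by (simp add: set_graph_def)
    ultimately show ?thesis
      by (simp add: graph halfspace_map_def)
  qed
  ultimately show thesis
    by (intro that) (auto simp: dual_def)
qed

section \<open>Properties of half-space maps: from (a) to (c)\<close>

context
  fixes \<xi> :: "'x::real_lcs \<Rightarrow> real" and \<zeta> :: "'z::real_lcs \<Rightarrow> real"
  assumes \<xi>: "\<xi> \<in> dual" and \<zeta>: "\<zeta> \<in> dual" "\<zeta> \<noteq> (\<lambda>_. 0)"
begin

lemma linear_\<xi>: "linear \<xi>" and linear_\<zeta>: "linear \<zeta>"
  using \<xi> \<zeta> by (simp_all add: dual_def)

lemma halfspace_map_0: "halfspace_map \<xi> \<zeta> 0 = {z. 0 \<le> \<zeta> z}"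
  by (simp add: halfspace_map_def linear_0[OF linear_\<xi>])

lemma halfspace_map_0_ne_UNIV: "halfspace_map \<xi> \<zeta> 0 \<noteq> UNIV"
proof -
  obtain w where "\<zeta> w = -1"
    using linear_real_surj[OF linear_\<zeta> \<zeta>(2)] .
  then have "w \<notin> halfspace_map \<xi> \<zeta> 0"
    by (simp add: halfspace_map_0)
  then show ?thesis
    by blast
qed

lemma positively_homogeneous_halfspace_map: "positively_homogeneous (halfspace_map \<xi> \<zeta>)"
  by (auto simp: positively_homogeneous_def is_cone_def set_graph_def halfspace_map_def
      linear_scale[OF linear_\<xi>] linear_scale[OF linear_\<zeta>])

lemma set_additive_halfspace_map: "set_additive (halfspace_map \<xi> \<zeta>)"
  by (simp add: set_additive_def halfspace_map_def closed_plus_halfspace[OF \<zeta>]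
      linear_add[OF linear_\<xi>])

lemma lattice_lsc_at_halfspace_map: "lattice_lsc_at (halfspace_map \<xi> \<zeta>) 0"
  unfolding lattice_lsc_at_def halfspace_map_0
proof
  fix z
  assume z: "z \<in> lattice_liminf (halfspace_map \<xi> \<zeta>) 0"
  show "z \<in> {z. 0 \<le> \<zeta> z}"
  proof (rule ccontr)
    assume "z \<notin> {z. 0 \<le> \<zeta> z}"
    then have neg: "\<zeta> z < \<zeta> z / 2" "\<zeta> z / 2 < 0"
      by auto
    \<comment> \<open>The threshold lies strictly between \<zeta> z and 0: being negative, it makes
      this set a neighborhood of 0, and the closed convex half-space that it bounds contains all
      values over the set but not z.\<close>
    let ?U = "{x. \<zeta> z / 2 < \<xi> x}"
    have "open ?U"
      using \<xi> by (intro open_Collect_less continuous_on_const) (simp add: dual_def)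
    then have "z \<in> closure (convex hull (\<Union>x\<in>?U. halfspace_map \<xi> \<zeta> x))"
      using z neg(2) by (auto simp: lattice_liminf_def linear_0[OF linear_\<xi>])
    moreover have "(\<Union>x\<in>?U. halfspace_map \<xi> \<zeta> x) \<subseteq> {w. \<zeta> z / 2 \<le> \<zeta> w}"
      by (auto simp: halfspace_map_def)
    then have "closure (convex hull (\<Union>x\<in>?U. halfspace_map \<xi> \<zeta> x)) \<subseteq> {w. \<zeta> z / 2 \<le> \<zeta> w}"
      by (intro closure_minimal hull_minimal closed_dual_halfspace \<zeta>
          convex_linear_halfspace linear_\<zeta>)
    ultimately show False
      using neg(1) by auto
  qed
qed

end

section \<open>Construction of the functional \<xi>: from (c) to (a)\<close>

lemma additive_lsc_imp_halfspace_map: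
  fixes f :: "'x::real_lcs \<Rightarrow> 'z::real_lcs set"
  assumes \<zeta>: "\<zeta> \<in> dual" "\<zeta> \<noteq> (\<lambda>_. 0)" and f0: "f 0 = {z. 0 \<le> \<zeta> z}"
    and closed: "\<And>x. closed (f x)"
    and hom: "positively_homogeneous f" and add: "set_additive f" and lsc: "lattice_lsc_at f 0"
  obtains \<xi> where "\<xi> \<in> dual" "\<And>x. f x = halfspace_map \<xi> \<zeta> x"
proof -
  have lin: "linear \<zeta>"
    using \<zeta> by (simp add: dual_def)
  have plus: "f (x + y) = closed_plus (f x) (f y)" for x y
    using add by (simp add: set_additive_def)
  have "\<exists>r. f x = {z. r \<le> \<zeta> z}" for x
  proof (rule closed_upper_set_eq_halfspace[OF \<zeta> closed])
    have *: "f x + f (- x) \<subseteq> f 0" "f 0 = closed_plus (f x) (f (- x))"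
      using plus[of x "- x"] set_plus_subset_closed_plus[of "f x" "f (- x)"] by auto
    have "0 \<in> f 0"
      by (simp add: f0 linear_0[OF lin])
    \<comment> \<open>The closure of this sum is \<open>f 0\<close>, which contains 0.\<close>
    then have "f x + f (- x) \<noteq> {}"
      using *(2) by (auto simp: closed_plus_def)
    then obtain v w where "v \<in> f x" and w: "w \<in> f (- x)"
      by (auto simp: set_plus_def)
    then show "f x \<noteq> {}"
      by blast
    show "bdd_below (\<zeta> ` f x)"
    proof (rule bdd_belowI2)
      fix z
      assume "z \<in> f x"
      then have "z + w \<in> f 0"
        using *(1) w by (auto intro: set_plus_intro)
      then show "- \<zeta> w \<le> \<zeta> z"
        by (simp add: f0 linear_add[OF lin])
    qed
    show "f x + {z. 0 \<le> \<zeta> z} \<subseteq> f x"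
      using plus[of x 0] set_plus_subset_closed_plus[of "f x" "f 0"] by (simp add: f0)
  qed
  then obtain \<xi> where f: "\<And>x. f x = {z. \<xi> x \<le> \<zeta> z}"
    by metis
  note inject = linear_halfspace_inject[OF lin \<zeta>(2)]
  have \<xi>_add: "\<xi> (x + y) = \<xi> x + \<xi> y" for x y
    using plus[of x y] by (simp add: f closed_plus_halfspace[OF \<zeta>] inject)
  have \<xi>_0: "\<xi> 0 = 0"
    using \<xi>_add[of 0 0] by simp
  have \<xi>_minus: "\<xi> (- x) = - \<xi> x" for x
    using \<xi>_add[of x "- x"] \<xi>_0 by simp
  \<comment> \<open>The cone property only transports points of the graph, hence yields an
    inequality; the boundary point w makes it sharp.\<close>
  have hom_le: "\<xi> (t *\<^sub>R x) \<le> t * \<xi> x" if "0 < t" for t x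
  proof -
    obtain w where w: "\<zeta> w = \<xi> x"
      using linear_real_surj[OF lin \<zeta>(2)] .
    then have "(x, w) \<in> set_graph f"
      by (simp add: set_graph_def f)
    then have "t *\<^sub>R (x, w) \<in> set_graph f"
      using hom that unfolding positively_homogeneous_def is_cone_def by blast
    then show ?thesis
      by (simp add: set_graph_def f linear_scale[OF lin] w)
  qed
  \<comment> \<open>The inequality at -x is the reverse inequality at x, since \<xi> is odd.\<close>
  have hom_pos: "\<xi> (t *\<^sub>R x) = t * \<xi> x" if "0 < t" for t x
    using hom_le[OF that, of x] hom_le[OF that, of "- x"] by (simp add: \<xi>_minus)
  have "\<xi> (t *\<^sub>R x) = t * \<xi> x" for t x
  proof (cases "t = 0" "0 < t" rule: bool.exhaust[case_product bool.exhaust])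
    case False_False
    then show ?thesis
      using hom_pos[of "- t" x] \<xi>_minus[of "t *\<^sub>R x"] by simp
  qed (auto simp: \<xi>_0 hom_pos)
  then have \<xi>_lin: "linear \<xi>"
    by (intro linearI) (simp_all add: \<xi>_add)
  \<comment> \<open>This w lies outside \<open>f 0\<close>, so semicontinuity gives a neighborhood U
    whose values all miss w. A point x of U with \<open>\<xi> x \<le> -1\<close> would have w in
    \<open>f x\<close>.\<close>
  obtain w where w: "\<zeta> w = -1"
    using linear_real_surj[OF lin \<zeta>(2)] .
  then have "w \<notin> lattice_liminf f 0"
    using lsc by (auto simp: lattice_lsc_at_def f0)
  then obtain U where U: "open U" "0 \<in> U" "w \<notin> closure (convex hull (\<Union>x\<in>U. f x))"
    by (auto simp: lattice_liminf_def)
  have "-1 < \<xi> x" if "x \<in> U" for x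
  proof (rule ccontr)
    assume "\<not> -1 < \<xi> x"
    then have "w \<in> (\<Union>x\<in>U. f x)"
      using that by (intro UN_I[of x]) (auto simp: f w)
    then show False
      using U(3) by (meson closure_subset hull_subset subsetD)
  qed
  then have "\<xi> \<in> dual"
    using \<xi>_lin U by (auto simp: dual_def intro: linear_bounded_below_nhds_imp_continuous)
  then show thesis
    by (rule that) (simp add: f halfspace_map_def)
qed

theorem theorem5p2:
  fixes C :: "'z::real_lcs set" and f :: "'x::real_lcs \<Rightarrow> 'z set"
  assumes "\<exists>x::'x. x \<noteq> 0" and "\<exists>z::'z. z \<noteq> 0"
    and "is_cone C" and "convex C" and "0 \<in> C"
    and "\<forall>x. f x \<in> closed_convex_upper_sets C"
  shows
    "((\<exists>\<xi>\<in>dual. \<exists>\<zeta>\<in>dual_cone C - {\<lambda>_. 0}. \<forall>x. f x = halfspace_map \<xi> \<zeta> x) \<longleftrightarrow>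
      closed_homogeneous_halfspace (set_graph f) \<and> f 0 \<noteq> UNIV) \<and>
     (closed_homogeneous_halfspace (set_graph f) \<and> f 0 \<noteq> UNIV \<longleftrightarrow>
      positively_homogeneous f \<and> set_additive f \<and> lattice_lsc_at f 0 \<and>
      closed_homogeneous_halfspace (f 0) \<and> f 0 \<noteq> UNIV)"
    (is "(?a \<longleftrightarrow> ?b) \<and> (?b \<longleftrightarrow> ?c)")
proof -
  \<comment> \<open>Since \<open>\<xi> 0 = 0\<close>, the value \<open>f 0\<close> contains 0 and
    therefore C, so \<zeta> is nonnegative on C.\<close>
  have dual_coneI: "\<zeta> \<in> dual_cone C"
    if "\<xi> \<in> dual" "\<zeta> \<in> dual" "\<And>x. f x = halfspace_map \<xi> \<zeta> x" for \<xi> \<zeta>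
  proof -
    have f0: "f 0 = {z. 0 \<le> \<zeta> z}" "0 \<in> f 0"
      using that by (auto simp: halfspace_map_def dual_def linear_0)
    then have "C \<subseteq> f 0"
      using closed_convex_upper_sets_imp_subset[OF assms(6)[rule_format]] by blast
    then show ?thesis
      using that f0 by (auto simp: dual_cone_def)
  qed
  \<comment> \<open>Both equivalences follow once (a) yields (b) and (c), and each of these yields
    (a).\<close>
  have "?b \<and> ?c" if ?a
  proof -
    obtain \<xi> \<zeta> where \<xi>: "\<xi> \<in> dual" and \<zeta>: "\<zeta> \<in> dual" "\<zeta> \<noteq> (\<lambda>_. 0)"
      and f: "f = halfspace_map \<xi> \<zeta>"
      using \<open>?a\<close> by (auto simp: dual_cone_def fun_eq_iff)
    have "closed_homogeneous_halfspace (f 0)"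
      using \<zeta> unfolding f halfspace_map_0[OF \<xi> \<zeta>] closed_homogeneous_halfspace_def by blast
    moreover have "closed_homogeneous_halfspace (set_graph f)"
      using halfspace_map_imp_graph_halfspace[OF \<xi> \<zeta>] f by simp
    ultimately show ?thesis
      using halfspace_map_0_ne_UNIV[OF \<xi> \<zeta>] positively_homogeneous_halfspace_map[OF \<xi> \<zeta>]
        set_additive_halfspace_map[OF \<xi> \<zeta>] lattice_lsc_at_halfspace_map[OF \<xi> \<zeta>]
      by (simp add: f)
  qed
  moreover have ?a if ?b
  proof -
    obtain \<xi> \<zeta> where \<xi>\<zeta>: "\<xi> \<in> dual" "\<zeta> \<in> dual" "\<And>x. f x = halfspace_map \<xi> \<zeta> x"
      using graph_halfspace_imp_halfspace_map \<open>?b\<close> by blast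
    \<comment> \<open>A vanishing \<zeta> would make \<open>f 0\<close> the whole space.\<close>
    then have "\<zeta> \<noteq> (\<lambda>_. 0)"
      using \<open>?b\<close> by (auto simp: halfspace_map_def dual_def linear_0)
    then show ?thesis
      using \<xi>\<zeta> dual_coneI[OF \<xi>\<zeta>] by blast
  qed
  moreover have ?a if ?c
  proof -
    obtain \<zeta> where \<zeta>: "\<zeta> \<in> dual" "\<zeta> \<noteq> (\<lambda>_. 0)" and f0: "f 0 = {z. 0 \<le> \<zeta> z}"
      using \<open>?c\<close> by (auto simp: closed_homogeneous_halfspace_def)
    moreover have "closed (f x)" for x
      using closed_convex_upper_sets_imp_closed[OF assms(6)[rule_format]] .
    ultimately obtain \<xi> where "\<xi> \<in> dual" "\<And>x. f x = halfspace_map \<xi> \<zeta> x"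
      using additive_lsc_imp_halfspace_map[of \<zeta> f] \<open>?c\<close> by blast
    then show ?thesis
      using \<zeta> dual_coneI by blast
  qed
  ultimately show ?thesis
    by blast
qed

end
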